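(* Let $\sigma,\tau,w$ on the fundamental interval $(a,b)$, the complementary polynomials ${\cal P}_\nu(x;l)$, and the generating function ${\cal P}(y,x;l)$ be as in the context, and let $l_1,l_2\ge0$ be integers. Then, for $x\in(a,b)$ and $|y|$ sufficiently small, $${\cal P}(y,x;l_1+l_2)\,{\cal P}(y,x;0)={\cal P}(y,x;l_1)\,{\cal P}(y,x;l_2),$$ and for every integer $\nu\ge0$, $$\sum_{\mu=0}^\nu\binom{\nu}{\mu}\Big[{\cal P}_\mu(x;l_1+l_2)\,{\cal P}_{\nu-\mu}(x;0)-{\cal P}_\mu(x;l_1)\,{\cal P}_{\nu-\mu}(x;l_2)\Big]=0.$$
   Context: $\sigma(x)=ex^2+2fx+g$ is a real polynomial of degree at most $2$ and $\tau(x)=a_l+b_lx$ is a real polynomial of degree at most $1$, whose coefficients may depend on $l$. The weight function $w$, possibly dependent on $l$, lives on the fundamental interval $(a,b)$, which contains no zero of $\sigma$; $w$ is nonvanishing there and satisfies Pearson's equation $\sigma(x)w'(x)=[\tau(x)-\sigma'(x)]w(x)$. With $P_l(x)=\frac{1}{w(x)}\frac{d^l}{dx^l}(\sigma(x)^lw(x))$, the complementary polynomials are introduced by $P_l(x)=\frac{1}{w(x)}\frac{d^{l-\nu}}{dx^{l-\nu}}\big(\sigma(x)^{l-\nu}w(x){\cal P}_\nu(x;l)\big)$; they are constructed from ${\cal P}_0(x;l)\equiv1$ by ${\cal P}_{\nu+1}(x;l)=\sigma(x)\frac{d}{dx}{\cal P}_\nu(x;l)+[\tau(x)+(l-\nu-1)\sigma'(x)]{\cal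 P}_\nu(x;l)$, and are given by ${\cal P}_\nu(x;l)=w(x)^{-1}\sigma(x)^{\nu-l}\frac{d^\nu}{dx^\nu}[w(x)\sigma(x)^l]$, $\nu=0,1,2,\dots$. The generating function is ${\cal P}(y,x;l)=\sum_{\nu=0}^{\infty}\frac{y^{\nu}}{\nu!}{\cal P}_{\nu}(x;l)$, convergent for $|y|<\epsilon$ for some $\epsilon>0$ at regular points $x\in(a,b)$, with closed form ${\cal P}(y,x;l)=\frac{w(x+y\sigma(x))}{w(x)}\Big(\frac{\sigma(x+y\sigma(x))}{\sigma(x)}\Big)^l$.
   Formalization: The polynomials σ, τ and the weight w are taken to be the same for all four indices l₁+l₂, 0, l₁, l₂ (l enters only through σ^l); if τ and w vary with l, the identity fails, e.g. σ=1, τ=l², w=exp(l²x), l₁=l₂=ν=1. *)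

theory Defs
  imports "HOL-Analysis.Analysis" "HOL-Computational_Algebra.Polynomial"
begin

text \<open>
  The data are fixed real polynomials \<open>\<sigma>\<close>, \<open>\<tau>\<close> and a weight \<open>w\<close>. If they depend on a parameter,
  that parameter is frozen: the index \<open>l\<close> below enters only through the exponent of \<open>\<sigma>\<close>.
  The Rodrigues-type formula makes sense where \<open>\<sigma>\<close> and \<open>w\<close> do not vanish; for \<open>\<nu> < l\<close> the exponent
  \<open>\<nu> - l\<close> is negative, hence the integer power.
\<close>

definition complementary :: "real poly \<Rightarrow> (real \<Rightarrow> real) \<Rightarrow> nat \<Rightarrow> nat \<Rightarrow> real \<Rightarrow> real" where
  "complementary \<sigma> w l \<nu> x =
     inverse (w x) * poly \<sigma> x powi (int \<nu> - int l) *
       (deriv ^^ \<nu>) (\<lambda>t. w t * poly \<sigma> t ^ l) x"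

definition gen_fun :: "real poly \<Rightarrow> (real \<Rightarrow> real) \<Rightarrow> nat \<Rightarrow> real \<Rightarrow> real \<Rightarrow> real" where
  "gen_fun \<sigma> w l y x = (\<Sum>\<nu>. y ^ \<nu> / fact \<nu> * complementary \<sigma> w l \<nu> x)"

text \<open>
  The polynomials produced by the recursion; lemma \<open>complementary_eq_poly\<close> shows that
  they agree with the Rodrigues-type formula on the fundamental interval.
\<close>

primrec complementary_poly :: "real poly \<Rightarrow> real poly \<Rightarrow> nat \<Rightarrow> nat \<Rightarrow> real poly" where
  "complementary_poly \<sigma> \<tau> l 0 = 1"
| "complementary_poly \<sigma> \<tau> l (Suc \<nu>) =
     \<sigma> * pderiv (complementary_poly \<sigma> \<tau> l \<nu>) +
     (\<tau> + smult (real l - real \<nu> - 1) (pderiv \<sigma>)) * complementary_poly \<sigma> \<tau> l \<nu>"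

lemma higher_deriv_weight:
  fixes \<sigma> \<tau> :: "real poly" and w :: "real \<Rightarrow> real"
  assumes I: "open I"
    and sig: "\<And>x. x \<in> I \<Longrightarrow> poly \<sigma> x \<noteq> 0"
    and wd: "\<And>x. x \<in> I \<Longrightarrow> w differentiable (at x)"
    and pearson: "\<And>x. x \<in> I \<Longrightarrow>
      poly \<sigma> x * deriv w x = (poly \<tau> x - poly (pderiv \<sigma>) x) * w x"
    and x: "x \<in> I"
  shows "(deriv ^^ \<nu>) (\<lambda>t. w t * poly \<sigma> t ^ l) x =
    w x * poly \<sigma> x powi (int l - int \<nu>) * poly (complementary_poly \<sigma> \<tau> l \<nu>) x"
  using x
proof (induction \<nu> arbitrary: x)
  case 0
  then show ?case by (simp add: power_int_def)
next
  case (Suc \<nu>)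
  let ?Q = "complementary_poly \<sigma> \<tau> l \<nu>" and ?k = "int l - int \<nu>"
  have s: "poly \<sigma> x \<noteq> 0" using sig Suc.prems by blast
  have ev: "\<forall>\<^sub>F t in nhds x. (deriv ^^ \<nu>) (\<lambda>t. w t * poly \<sigma> t ^ l) t =
      w t * poly \<sigma> t powi ?k * poly ?Q t"
    using eventually_nhds_in_open[OF I Suc.prems] by eventually_elim (rule Suc.IH)
  have w': "(w has_real_derivative (poly \<tau> x - poly (pderiv \<sigma>) x) * w x / poly \<sigma> x) (at x)"
  proof -
    have "(w has_real_derivative deriv w x) (at x)"
      using wd[OF Suc.prems] DERIV_deriv_iff_real_differentiable by blast
    moreover have "deriv w x = (poly \<tau> x - poly (pderiv \<sigma>) x) * w x / poly \<sigma> x"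
      using pearson[OF Suc.prems] s by (simp add: field_simps)
    ultimately show ?thesis by simp
  qed
  have p: "poly \<sigma> x powi ?k = poly \<sigma> x * poly \<sigma> x powi (?k - 1)"
    using s by (simp add: power_int_diff)
  have "((\<lambda>t. w t * poly \<sigma> t powi ?k * poly ?Q t) has_real_derivative
      w x * poly \<sigma> x powi (?k - 1) * poly (complementary_poly \<sigma> \<tau> l (Suc \<nu>)) x) (at x)"
  proof -
    have "((\<lambda>t. poly \<sigma> t powi ?k) has_real_derivative
        of_int ?k * poly \<sigma> x powi (?k - 1) * poly (pderiv \<sigma>) x) (at x)"
      using DERIV_power_int[OF poly_DERIV disjI2[OF s], of ?k] by simp
    from DERIV_mult[OF DERIV_mult[OF w' this] poly_DERIV[of ?Q x]]
    show ?thesis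
      by (rule DERIV_cong) (use s in \<open>simp add: p, simp add: field_simps\<close>)
  qed
  then have "deriv (\<lambda>t. w t * poly \<sigma> t powi ?k * poly ?Q t) x =
      w x * poly \<sigma> x powi (?k - 1) * poly (complementary_poly \<sigma> \<tau> l (Suc \<nu>)) x"
    by (rule DERIV_imp_deriv)
  moreover have "int l - int (Suc \<nu>) = ?k - 1" by simp
  ultimately show ?case
    using deriv_cong_ev[OF ev refl] by (simp only: funpow.simps o_apply)
qed

lemma complementary_eq_poly:
  fixes \<sigma> \<tau> :: "real poly" and w :: "real \<Rightarrow> real"
  assumes I: "open I"
    and sig: "\<And>x. x \<in> I \<Longrightarrow> poly \<sigma> x \<noteq> 0"
    and w0: "\<And>x. x \<in> I \<Longrightarrow> w x \<noteq> 0"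
    and wd: "\<And>x. x \<in> I \<Longrightarrow> w differentiable (at x)"
    and pearson: "\<And>x. x \<in> I \<Longrightarrow>
      poly \<sigma> x * deriv w x = (poly \<tau> x - poly (pderiv \<sigma>) x) * w x"
    and x: "x \<in> I"
  shows "complementary \<sigma> w l \<nu> x = poly (complementary_poly \<sigma> \<tau> l \<nu>) x"
proof -
  have "poly \<sigma> x powi (int \<nu> - int l) * poly \<sigma> x powi (int l - int \<nu>) = 1"
    using sig[OF x] by (simp flip: power_int_add)
  then show ?thesis
    using w0[OF x] higher_deriv_weight[OF I sig wd pearson x, of \<nu> l]
    by (simp add: complementary_def field_simps)
qed

end

theory Submission
  imports Defs
begin

unbundle no vec_syntax
unbundle fps_syntax

text \<open>
  With \<open>\<psi> = \<tau> + (l - 1) \<sigma>'\<close> one has \<open>P\<^sub>\<nu>\<^sub>+\<^sub>1' = (\<nu> + 1) (\<psi>' - \<nu> \<sigma>'' / 2) P\<^sub>\<nu>\<close>, which turns the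
  differential recursion into a three-term recurrence in \<open>\<nu>\<close> at each fixed \<open>x\<close>. It bounds
  \<open>P\<^sub>\<nu>(x) / \<nu>!\<close> geometrically and says that the generating series \<open>G\<^sub>l\<close> in \<open>y\<close> solves
  \<open>D G\<^sub>l' = N\<^sub>l G\<^sub>l\<close>, where \<open>D = \<sigma>(x + y \<sigma>(x)) / \<sigma>(x)\<close> and \<open>N\<^sub>l = \<psi>(x + y \<sigma>(x))\<close>.
  Since \<open>N\<^sub>l\<close> is affine in \<open>l\<close>, the products \<open>G\<^bsub>l\<^sub>1+l\<^sub>2\<^esub> G\<^sub>0\<close> and \<open>G\<^bsub>l\<^sub>1\<^esub> G\<^bsub>l\<^sub>2\<^esub>\<close> solve the same
  first-order equation with the same initial value, hence coincide.
\<close>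

text \<open>Differentiating the recursion for \<open>P (Suc (Suc n))\<close> and inserting the
  induction hypothesis gives \<open>P (Suc n)\<close> twice: with the old factor \<open>c\<close>,
  and with the slope of the affine polynomial \<open>\<rho> (Suc n)\<close>. Explicit coefficients
  encode the degree bounds, and \<open>s2\<close> is half of \<sigma>''.\<close>

lemma pderiv_complementary_poly:
  fixes s0 s1 s2 t0 t1 :: real
  defines "\<sigma> \<equiv> [:s0, s1, s2:]" and "\<tau> \<equiv> [:t0, t1:]"
  shows "pderiv (complementary_poly \<sigma> \<tau> l (Suc n)) =
    smult (real (Suc n) * (t1 + 2 * s2 * (real l - 1) - real n * s2)) (complementary_poly \<sigma> \<tau> l n)"
proof (induction n)
  case 0
  show ?case
    by (simp add: \<sigma>_def \<tau>_def pderiv_pCons algebra_simps)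
next
  case (Suc n)
  define P where "P = complementary_poly \<sigma> \<tau> l"
  define c where "c = real (Suc n) * (t1 + 2 * s2 * (real l - 1) - real n * s2)"
  define \<rho> where "\<rho> k = \<tau> + smult (real l - real k - 1) (pderiv \<sigma>)" for k
  have IH: "pderiv (P (Suc n)) = smult c (P n)"
    using Suc.IH by (simp only: P_def c_def)
  have rec: "P (Suc k) = \<sigma> * pderiv (P k) + \<rho> k * P k" for k
    by (simp add: P_def \<rho>_def)
  \<comment> \<open>The \<sigma>' from the product rule lowers the index of \<open>\<rho>\<close> by
    one, so the recursion that defines \<open>P (Suc n)\<close> reappears.\<close>
  have \<rho>_shift: "pderiv \<sigma> + \<rho> (Suc n) = \<rho> n"
    by (simp add: \<rho>_def \<sigma>_def \<tau>_def pderiv_pCons algebra_simps)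
  have \<rho>': "pderiv (\<rho> (Suc n)) = [:t1 + 2 * s2 * (real l - real n - 2):]"
    by (simp add: \<rho>_def \<sigma>_def \<tau>_def pderiv_pCons pderiv_add pderiv_smult algebra_simps)
  have "pderiv (P (Suc (Suc n))) =
      \<sigma> * smult c (pderiv (P n)) + (pderiv \<sigma> + \<rho> (Suc n)) * smult c (P n)
        + pderiv (\<rho> (Suc n)) * P (Suc n)"
    by (simp only: rec[of "Suc n"] pderiv_add pderiv_mult IH pderiv_smult) (simp add: algebra_simps)
  also have "\<dots> = smult c (P (Suc n)) + smult (t1 + 2 * s2 * (real l - real n - 2)) (P (Suc n))"
    unfolding \<rho>_shift \<rho>' by (simp add: rec[of n] smult_add_right)
  also have "\<dots> = smult (c + (t1 + 2 * s2 * (real l - real n - 2))) (P (Suc n))"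
    by (simp add: smult_add_left)
  also have "c + (t1 + 2 * s2 * (real l - real n - 2)) =
      real (Suc (Suc n)) * (t1 + 2 * s2 * (real l - 1) - real (Suc n) * s2)"
    by (simp add: c_def algebra_simps)
  finally show ?case by (simp only: P_def)
qed

text \<open>A formal series in y with \<open>x\<close> frozen, so the algebra below needs no
  convergence; it does not mention \<open>w\<close> and makes sense even at zeros of
  \<sigma>.\<close>

definition complementary_fps :: "real poly \<Rightarrow> real poly \<Rightarrow> nat \<Rightarrow> real \<Rightarrow> real fps" where
  "complementary_fps \<sigma> \<tau> l x = Abs_fps (\<lambda>\<nu>. poly (complementary_poly \<sigma> \<tau> l \<nu>) x / fact \<nu>)"

lemma complementary_fps_nth_0 [simp]: "complementary_fps \<sigma> \<tau> l x $ 0 = 1"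
  by (simp add: complementary_fps_def)

lemma complementary_fps_nth_1:
  "complementary_fps \<sigma> \<tau> l x $ Suc 0 = poly \<tau> x + (real l - 1) * poly (pderiv \<sigma>) x"
  by (simp add: complementary_fps_def)

text \<open>The derivative identity removes differentiation in \<open>x\<close> from the recursion;
  its factor \<open>Suc n\<close> turns \<open>fact (Suc n)\<close> into \<open>fact n\<close> in
  the last term.\<close>

lemma complementary_fps_recurrence:
  fixes s0 s1 s2 t0 t1 :: real
  defines "\<sigma> \<equiv> [:s0, s1, s2:]" and "\<tau> \<equiv> [:t0, t1:]"
  shows "real (Suc (Suc n)) * complementary_fps \<sigma> \<tau> l x $ Suc (Suc n) =
    (poly \<tau> x + (real l - real n - 2) * poly (pderiv \<sigma>) x) * complementary_fps \<sigma> \<tau> l x $ Suc n +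
    (t1 + 2 * s2 * (real l - 1) - real n * s2) * poly \<sigma> x * complementary_fps \<sigma> \<tau> l x $ n"
proof -
  define P where "P k = poly (complementary_poly \<sigma> \<tau> l k) x" for k
  define \<kappa> where "\<kappa> = t1 + 2 * s2 * (real l - 1) - real n * s2"
  define r where "r = poly \<tau> x + (real l - real n - 2) * poly (pderiv \<sigma>) x"
  have "P (Suc (Suc n)) =
      poly \<sigma> x * poly (pderiv (complementary_poly \<sigma> \<tau> l (Suc n))) x + r * P (Suc n)"
    unfolding P_def r_def
    by (subst complementary_poly.simps(2)) (simp del: complementary_poly.simps add: algebra_simps)
  also have "poly (pderiv (complementary_poly \<sigma> \<tau> l (Suc n))) x = real (Suc n) * \<kappa> * P n"
    unfolding \<sigma>_def \<tau>_def pderiv_complementary_poly by (simp add: P_def \<kappa>_def \<sigma>_def \<tau>_def)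
  finally have P: "P (Suc (Suc n)) = poly \<sigma> x * (real (Suc n) * \<kappa> * P n) + r * P (Suc n)" .
  have nth: "complementary_fps \<sigma> \<tau> l x $ k = P k / fact k" for k
    by (simp add: complementary_fps_def P_def)
  have "real (Suc (Suc n)) * (P (Suc (Suc n)) / fact (Suc (Suc n))) = P (Suc (Suc n)) / fact (Suc n)"
    by (simp add: field_simps del: of_nat_Suc)
  also have "\<dots> = r * (P (Suc n) / fact (Suc n)) + \<kappa> * poly \<sigma> x * (P n / fact n)"
    unfolding P by (simp add: field_simps del: of_nat_Suc)
  finally show ?thesis
    by (simp only: nth r_def \<kappa>_def)
qed

text \<open>Coefficient comparison with the three-term recurrence. The factor on the left is
  \<sigma>(x + y \<sigma>(x)) / \<sigma>(x) after Taylor expansion and cancellation, hence has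
  constant term 1.\<close>

lemma complementary_fps_ODE:
  fixes s0 s1 s2 t0 t1 :: real
  defines "\<sigma> \<equiv> [:s0, s1, s2:]" and "\<tau> \<equiv> [:t0, t1:]"
  shows "(1 + fps_const (poly (pderiv \<sigma>) x) * fps_X + fps_const (s2 * poly \<sigma> x) * fps_X\<^sup>2)
      * fps_deriv (complementary_fps \<sigma> \<tau> l x) =
    (fps_const (poly \<tau> x + (real l - 1) * poly (pderiv \<sigma>) x) +
      fps_const ((t1 + 2 * s2 * (real l - 1)) * poly \<sigma> x) * fps_X) * complementary_fps \<sigma> \<tau> l x"
  (is "?L = ?R")
proof (rule fps_ext)
  fix n
  \<comment> \<open>The \<open>fps_X\<^sup>2\<close> term contributes only from index 2 on; index 0
    is the explicit first coefficient, and indices 1 and \<open>Suc (Suc m)\<close> are the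
    recurrence at 0 and \<open>Suc m\<close>.\<close>
  consider "n = 0" | "n = 1" | m where "n = Suc (Suc m)"
    by (metis One_nat_def not0_implies_Suc)
  then show "?L $ n = ?R $ n"
  proof cases
    case 1
    then show ?thesis
      by (simp add: complementary_fps_nth_1 distrib_right mult.assoc)
  next
    case 2
    then show ?thesis
      using complementary_fps_recurrence[of 0 s0 s1 s2 t0 t1 l x, folded \<sigma>_def \<tau>_def]
      by (simp add: power2_eq_square algebra_simps)
  next
    case 3
    then show ?thesis
      using complementary_fps_recurrence[of "Suc m" s0 s1 s2 t0 t1 l x, folded \<sigma>_def \<tau>_def]
      by (simp add: fps_X_power_mult_nth algebra_simps)
  qed
qed

text \<open>If the difference \<open>E\<close> had order \<open>Suc n\<close>, then
  \<open>D * fps_deriv E\<close> would have order exactly \<open>n\<close>, as \<open>D $ 0\<close>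
  is nonzero and the characteristic is 0, whereas \<open>N * E\<close> has no coefficient at
  \<open>n\<close>.\<close>

lemma fps_linear_ODE_unique:
  fixes A B D N :: "'a :: field_char_0 fps"
  assumes A: "D * fps_deriv A = N * A" and B: "D * fps_deriv B = N * B"
    and "D $ 0 \<noteq> 0" and "A $ 0 = B $ 0"
  shows "A = B"
proof (rule ccontr)
  assume "A \<noteq> B"
  define E where "E = A - B"
  have E: "D * fps_deriv E = N * E"
    using A B by (simp add: E_def algebra_simps)
  have E0: "E \<noteq> 0" "E $ 0 = 0"
    using \<open>A \<noteq> B\<close> assms(4) by (simp_all add: E_def)
  obtain n where n: "subdegree E = Suc n"
    using E0 by (metis not0_implies_Suc nth_subdegree_nonzero)
  have low: "E $ k = 0" if "k \<le> n" for k
    by (rule nth_less_subdegree_zero) (use that n in linarith)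
  have "(D * fps_deriv E) $ n = (\<Sum>i=0..n. D $ i * (of_nat (Suc (n - i)) * E $ Suc (n - i)))"
    by (simp add: fps_mult_nth)
  also have "\<dots> = (\<Sum>i\<in>{0}. D $ i * (of_nat (Suc (n - i)) * E $ Suc (n - i)))"
    by (intro sum.mono_neutral_right) (auto simp: low simp del: of_nat_Suc)
  finally have "(D * fps_deriv E) $ n = D $ 0 * (of_nat (Suc n) * E $ Suc n)"
    by simp
  moreover have "(N * E) $ n = 0"
    unfolding fps_mult_nth by (auto intro!: sum.neutral simp: low)
  ultimately show False
    using E assms(3) nth_subdegree_nonzero[OF E0(1)] n by (simp del: of_nat_Suc)
qed

lemma poly_degree_le_2E:
  fixes p :: "'a :: zero poly"
  assumes "degree p \<le> 2"
  obtains p0 p1 p2 where "p = [:p0, p1, p2:]"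
proof
  show "p = [:coeff p 0, coeff p 1, coeff p 2:]"
    using assms by (auto simp: poly_eq_iff coeff_pCons coeff_eq_0 numeral_2_eq_2 split: nat.split)
qed

lemma poly_degree_le_1E:
  fixes p :: "'a :: zero poly"
  assumes "degree p \<le> 1"
  obtains p0 p1 where "p = [:p0, p1:]"
proof
  show "p = [:coeff p 0, coeff p 1:]"
    using assms by (auto simp: poly_eq_iff coeff_pCons coeff_eq_0 split: nat.split)
qed

lemma complementary_fps_mult:
  assumes "degree \<sigma> \<le> 2" and "degree \<tau> \<le> 1"
  shows "complementary_fps \<sigma> \<tau> (l1 + l2) x * complementary_fps \<sigma> \<tau> 0 x =
    complementary_fps \<sigma> \<tau> l1 x * complementary_fps \<sigma> \<tau> l2 x"
proof -
  obtain s0 s1 s2 where \<sigma>: "\<sigma> = [:s0, s1, s2:]"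
    using assms(1) by (rule poly_degree_le_2E)
  obtain t0 t1 where \<tau>: "\<tau> = [:t0, t1:]"
    using assms(2) by (rule poly_degree_le_1E)
  define G where "G l = complementary_fps \<sigma> \<tau> l x" for l
  define D where "D = 1 + fps_const (poly (pderiv \<sigma>) x) * fps_X + fps_const (s2 * poly \<sigma> x) * fps_X\<^sup>2"
  define N where "N r = fps_const (poly \<tau> x + (r - 1) * poly (pderiv \<sigma>) x) +
      fps_const ((t1 + 2 * s2 * (r - 1)) * poly \<sigma> x) * fps_X" for r
  have ODE: "D * fps_deriv (G l) = N (real l) * G l" for l
    unfolding D_def N_def G_def \<sigma> \<tau> by (rule complementary_fps_ODE)
  \<comment> \<open>Logarithmic derivatives add under products; as \<open>N\<close> is affine, only
    the sum of the indices will matter.\<close>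
  have prod_ODE: "D * fps_deriv (G k * G l) = (N (real k) + N (real l)) * (G k * G l)" for k l
  proof -
    have "D * fps_deriv (G k * G l) = G k * (D * fps_deriv (G l)) + (D * fps_deriv (G k)) * G l"
      by (simp add: algebra_simps)
    then show ?thesis
      unfolding ODE by (simp add: algebra_simps)
  qed
  have "N (real (l1 + l2)) + N (real 0) = N (real l1) + N (real l2)"
    by (rule fps_ext) (simp add: N_def fps_X_def algebra_simps)
  then have "D * fps_deriv (G (l1 + l2) * G 0) = (N (real l1) + N (real l2)) * (G (l1 + l2) * G 0)"
    by (simp only: prod_ODE)
  moreover have "D $ 0 \<noteq> 0"
    by (simp add: D_def)
  moreover have "(G (l1 + l2) * G 0) $ 0 = (G l1 * G l2) $ 0"
    by (simp add: G_def)
  ultimately have "G (l1 + l2) * G 0 = G l1 * G l2"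
    by (rule fps_linear_ODE_unique[OF _ prod_ODE])
  then show ?thesis by (simp only: G_def)
qed

lemma complementary_fps_conv_radius_pos:
  assumes "degree \<sigma> \<le> 2" and "degree \<tau> \<le> 1"
  shows "fps_conv_radius (complementary_fps \<sigma> \<tau> l x) > 0"
proof -
  obtain s0 s1 s2 where \<sigma>: "\<sigma> = [:s0, s1, s2:]"
    using assms(1) by (rule poly_degree_le_2E)
  obtain t0 t1 where \<tau>: "\<tau> = [:t0, t1:]"
    using assms(2) by (rule poly_degree_le_1E)
  define c where "c n = complementary_fps \<sigma> \<tau> l x $ n" for n
  define p where "p = poly \<tau> x + (real l - 1) * poly (pderiv \<sigma>) x"
  define d where "d = poly (pderiv \<sigma>) x"
  define q where "q = (t1 + 2 * s2 * (real l - 1)) * poly \<sigma> x"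
  define e where "e = s2 * poly \<sigma> x"
  \<comment> \<open>\<open>M\<close> dominates the sum of the recurrence coefficients after division
    by the leading index; the summand 1 makes its powers increasing.\<close>
  define M where "M = 1 + \<bar>p\<bar> + \<bar>d\<bar> + \<bar>q\<bar> + \<bar>e\<bar>"
  have M: "M \<ge> 1" by (simp add: M_def)
  have rec: "real (Suc (Suc n)) * c (Suc (Suc n)) =
      (p - real (Suc n) * d) * c (Suc n) + (q - real n * e) * c n" for n
    using complementary_fps_recurrence[of n s0 s1 s2 t0 t1 l x, folded \<sigma> \<tau>]
    by (simp add: c_def p_def d_def q_def e_def algebra_simps)
  \<comment> \<open>Two consecutive bounds are carried because the recurrence has order two.\<close>
  have bound: "\<bar>c n\<bar> \<le> M ^ n \<and> \<bar>c (Suc n)\<bar> \<le> M ^ Suc n" for n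
  proof (induction n)
    case 0
    then show ?case
      using complementary_fps_nth_1[of \<sigma> \<tau> l x] by (simp add: c_def M_def p_def)
  next
    case (Suc n)
    let ?k = "real (Suc (Suc n))"
    have cn: "\<bar>c n\<bar> \<le> M ^ Suc n"
      using Suc.IH power_increasing[of n "Suc n" M] M by linarith
    have "\<bar>p - real (Suc n) * d\<bar> \<le> \<bar>p\<bar> + real (Suc n) * \<bar>d\<bar>"
      using abs_triangle_ineq4[of p "real (Suc n) * d"] by (simp add: abs_mult)
    \<comment> \<open>Giving every term the factor \<open>?k\<close> lets it cancel against the
      leading coefficient, so the linear growth in \<open>n\<close> disappears.\<close>
    also have "\<dots> \<le> ?k * \<bar>p\<bar> + ?k * \<bar>d\<bar>"
      by (intro add_mono mult_right_mono) (auto intro: mult_right_mono[of 1 _ "\<bar>p\<bar>", simplified])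
    finally have 1: "\<bar>p - real (Suc n) * d\<bar> \<le> ?k * (\<bar>p\<bar> + \<bar>d\<bar>)" by (simp add: algebra_simps)
    have "\<bar>q - real n * e\<bar> \<le> \<bar>q\<bar> + real n * \<bar>e\<bar>"
      using abs_triangle_ineq4[of q "real n * e"] by (simp add: abs_mult)
    also have "\<dots> \<le> ?k * \<bar>q\<bar> + ?k * \<bar>e\<bar>"
      by (intro add_mono mult_right_mono) (auto intro: mult_right_mono[of 1 _ "\<bar>q\<bar>", simplified])
    finally have 2: "\<bar>q - real n * e\<bar> \<le> ?k * (\<bar>q\<bar> + \<bar>e\<bar>)" by (simp add: algebra_simps)
    have "?k * \<bar>c (Suc (Suc n))\<bar> = \<bar>?k * c (Suc (Suc n))\<bar>"
      by (simp add: abs_mult)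
    also have "\<dots> \<le> \<bar>p - real (Suc n) * d\<bar> * \<bar>c (Suc n)\<bar> + \<bar>q - real n * e\<bar> * \<bar>c n\<bar>"
      unfolding rec by (metis abs_mult abs_triangle_ineq)
    also have "\<dots> \<le> ?k * (\<bar>p\<bar> + \<bar>d\<bar>) * M ^ Suc n + ?k * (\<bar>q\<bar> + \<bar>e\<bar>) * M ^ Suc n"
      using Suc.IH cn by (intro add_mono mult_mono 1 2) auto
    also have "\<dots> = ?k * ((\<bar>p\<bar> + \<bar>d\<bar> + \<bar>q\<bar> + \<bar>e\<bar>) * M ^ Suc n)"
      by (simp only: algebra_simps)
    also have "\<dots> \<le> ?k * (M * M ^ Suc n)"
      using M by (intro mult_left_mono mult_right_mono) (auto simp: M_def)
    finally have "\<bar>c (Suc (Suc n))\<bar> \<le> M ^ Suc (Suc n)"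
      by (simp del: of_nat_Suc)
    with Suc.IH show ?case by blast
  qed
  \<comment> \<open>At half of \<open>1 / M\<close> the bound leaves a geometric series of ratio
    1/2.\<close>
  have "summable (\<lambda>n. c n * (1 / (2 * M)) ^ n)"
  proof (rule summable_comparison_test')
    show "summable (\<lambda>n. (1 / 2 :: real) ^ n)" by (rule summable_geometric) simp
    show "norm (c n * (1 / (2 * M)) ^ n) \<le> (1 / 2) ^ n" if "n \<ge> 0" for n
      using bound[of n] M by (simp add: abs_mult field_simps)
  qed
  then have "fps_conv_radius (complementary_fps \<sigma> \<tau> l x) \<ge> norm (1 / (2 * M))"
    unfolding fps_conv_radius_def c_def by (rule conv_radius_geI)
  moreover have "ereal (norm (1 / (2 * M))) > 0" using M by simp
  ultimately show ?thesis by (rule less_le_trans[rotated])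
qed

theorem mainTheorem7:
  fixes \<sigma> \<tau> :: "real poly" and w :: "real \<Rightarrow> real" and a b :: ereal and l1 l2 :: nat
  assumes "a < b"
    and "degree \<sigma> \<le> 2" and "degree \<tau> \<le> 1"
    and "\<forall>x\<in>einterval a b. poly \<sigma> x \<noteq> 0"
    and "\<forall>x\<in>einterval a b. w x \<noteq> 0"
    and "\<forall>x\<in>einterval a b. w differentiable (at x)"
    and "\<forall>x\<in>einterval a b.
           poly \<sigma> x * deriv w x = (poly \<tau> x - poly (pderiv \<sigma>) x) * w x"
  shows "(\<forall>x\<in>einterval a b. \<exists>\<epsilon>>0. \<forall>y. \<bar>y\<bar> < \<epsilon> \<longrightarrow>
            (\<forall>l\<in>{l1 + l2, 0, l1, l2}.
               summable (\<lambda>\<nu>. y ^ \<nu> / fact \<nu> * complementary \<sigma> w l \<nu> x)) \<and>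
            gen_fun \<sigma> w (l1 + l2) y x * gen_fun \<sigma> w 0 y x =
              gen_fun \<sigma> w l1 y x * gen_fun \<sigma> w l2 y x) \<and>
         (\<forall>x\<in>einterval a b. \<forall>\<nu>.
            (\<Sum>\<mu>=0..\<nu>. real (\<nu> choose \<mu>) *
               (complementary \<sigma> w (l1 + l2) \<mu> x * complementary \<sigma> w 0 (\<nu> - \<mu>) x -
                complementary \<sigma> w l1 \<mu> x * complementary \<sigma> w l2 (\<nu> - \<mu>) x)) = 0)"
proof (intro conjI ballI allI)
  fix x assume x: "x \<in> einterval a b"
  define G where "G l = complementary_fps \<sigma> \<tau> l x" for l
  have nth: "complementary \<sigma> w l \<nu> x = fact \<nu> * G l $ \<nu>" for l \<nu>
    using complementary_eq_poly[OF open_einterval, of a b \<sigma> w \<tau> x l \<nu>] assms x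
    by (simp add: G_def complementary_fps_def)
  \<comment> \<open>Both claims follow from this formal identity: evaluation gives the first,
    comparison of coefficients the second.\<close>
  have mult: "G (l1 + l2) * G 0 = G l1 * G l2"
    unfolding G_def using assms(2,3) by (rule complementary_fps_mult)
  {
    \<comment> \<open>One radius serves all four series. It may be infinite, so a real \<epsilon>
      strictly below it is chosen.\<close>
    define R where "R = Min ((\<lambda>l. fps_conv_radius (G l)) ` {l1 + l2, 0, l1, l2})"
    have "R > 0"
      unfolding R_def G_def using complementary_fps_conv_radius_pos[OF assms(2,3)] by simp
    then obtain \<epsilon> where \<epsilon>: "0 < ereal \<epsilon>" "ereal \<epsilon> < R"
      using ereal_dense2 by blast
    have conv: "ereal (norm y) < fps_conv_radius (G l)"
      if "\<bar>y\<bar> < \<epsilon>" "l \<in> {l1 + l2, 0, l1, l2}" for y l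
    proof -
      have "R \<le> fps_conv_radius (G l)"
        unfolding R_def using that(2) by (intro Min_le) auto
      then show ?thesis
        using \<epsilon>(2) that(1) by (metis ereal_less_eq(3) less_imp_le less_le_trans order_le_less_trans real_norm_def)
    qed
    have gen_fun: "gen_fun \<sigma> w l y x = eval_fps (G l) y" for l y
      by (simp add: gen_fun_def eval_fps_def nth mult.commute)
    show "\<exists>\<epsilon>>0. \<forall>y. \<bar>y\<bar> < \<epsilon> \<longrightarrow>
            (\<forall>l\<in>{l1 + l2, 0, l1, l2}.
               summable (\<lambda>\<nu>. y ^ \<nu> / fact \<nu> * complementary \<sigma> w l \<nu> x)) \<and>
            gen_fun \<sigma> w (l1 + l2) y x * gen_fun \<sigma> w 0 y x =
              gen_fun \<sigma> w l1 y x * gen_fun \<sigma> w l2 y x"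
    proof (intro exI[of _ \<epsilon>] conjI allI impI ballI)
      show "\<epsilon> > 0" using \<epsilon>(1) by simp
    next
      fix y l assume "\<bar>y\<bar> < \<epsilon>" "l \<in> {l1 + l2, 0, l1, l2}"
      from summable_fps[OF conv[OF this]]
      show "summable (\<lambda>\<nu>. y ^ \<nu> / fact \<nu> * complementary \<sigma> w l \<nu> x)"
        by (simp add: nth mult.commute)
    next
      fix y assume y: "\<bar>y\<bar> < \<epsilon>"
      show "gen_fun \<sigma> w (l1 + l2) y x * gen_fun \<sigma> w 0 y x =
          gen_fun \<sigma> w l1 y x * gen_fun \<sigma> w l2 y x"
        unfolding gen_fun using mult conv[OF y] by (simp flip: eval_fps_mult)
    qed
  next
    fix \<nu>
    \<comment> \<open>The factorials from \<open>nth\<close> cancel the denominators of the binomial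
      coefficient, leaving a Cauchy product times \<open>fact \<nu>\<close>.\<close>
    have conv: "(\<Sum>\<mu>=0..\<nu>. real (\<nu> choose \<mu>) *
        (complementary \<sigma> w k \<mu> x * complementary \<sigma> w l (\<nu> - \<mu>) x)) = fact \<nu> * (G k * G l) $ \<nu>" for k l
      unfolding fps_mult_nth sum_distrib_left
      by (intro sum.cong) (auto simp: nth binomial_fact)
    show "(\<Sum>\<mu>=0..\<nu>. real (\<nu> choose \<mu>) *
               (complementary \<sigma> w (l1 + l2) \<mu> x * complementary \<sigma> w 0 (\<nu> - \<mu>) x -
                complementary \<sigma> w l1 \<mu> x * complementary \<sigma> w l2 (\<nu> - \<mu>) x)) = 0"
      by (simp add: right_diff_distrib sum_subtractf conv mult)
  }
qed

end
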